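(* Let $R$ be a commutative domain with $1$, let $q\in R$ be invertible, let $m,n\ge 0$ be integers with $m+n\ge 1$, and let $r\ge 1$. Let $V=\bigoplus_{k=1}^{m+n}Rv_k$ be the $\mathbb{Z}_2$-graded free $R$-module with $|v_k|=0$ for $1\le k\le m$ and $|v_k|=1$ for $m+1\le k\le m+n$. Let $T$ be the $R$-linear right operator on $V\otimes V$ given by $$(v_k\otimes v_l)T=\begin{cases}\dfrac{(-1)^{|v_k|}(q+q^{-1})+q-q^{-1}}{2}\,v_k\otimes v_l & \text{if } k=l,\\ (-1)^{|v_k||v_l|}v_l\otimes v_k+(q-q^{-1})v_k\otimes v_l & \text{if } k<l,\\ (-1)^{|v_k||v_l|}v_l\otimes v_k & \text{if } k>l,\end{cases}$$ where the coefficient in the case $k=l$ means $q$ if $|v_k|=0$ and $-q^{-1}$ if $|v_k|=1$. Then the assignment $$\pi_r(T_i)=\operatorname{Id}^{\otimes (i-1)}\otimes T\otimes \operatorname{Id}^{\otimes (r-i-1)}\qquad (i=1,\dots,r-1),$$ where $\operatorname{Id}$ is the identity of $V$, defines a (right) representation of the Iwahori-Hecke algebra $\mathcal{H}_{R,r}(q)$ on $V^{\otimes r}$.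
   Context: The Iwahori-Hecke algebra $\mathcal{H}_{R,r}(q)$ of type $A$ is the unital associative $R$-algebra generated by $T_1,\dots,T_{r-1}$ with defining relations: $T_i^2=(q-q^{-1})T_i+1$ for $1\le i\le r-1$; $T_iT_{i+1}T_i=T_{i+1}T_iT_{i+1}$ for $1\le i\le r-2$; $T_iT_j=T_jT_i$ for $|i-j|>1$. Operators of the Hecke algebra are written on the right of vectors, and all tensor products are over $R$. *)

theory Defs
  imports "HOL-Library.Poly_Mapping" "HOL-Algebra.QuotRing" "HOL-Algebra.Module"
begin

section \<open>The free associative algebra\<close>

text \<open>
  Words form a monoid under concatenation, so the convolution product of
  \<^theory>\<open>HOL-Library.Poly_Mapping\<close> makes the finitely supported functions on words the free
  associative unital algebra on the letters.
\<close>

instantiation list :: (type) monoid_add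
begin
definition zero_list :: "'a list" where "zero_list = []"
definition plus_list :: "'a list \<Rightarrow> 'a list \<Rightarrow> 'a list" where "plus_list u w = u @ w"
instance by standard (simp_all add: zero_list_def plus_list_def)
end

type_synonym 'a freealg = "nat list \<Rightarrow>\<^sub>0 'a"

definition word :: "nat list \<Rightarrow> 'a::comm_ring_1 freealg" where
  "word w = Poly_Mapping.single w 1"

definition scal :: "'a::comm_ring_1 \<Rightarrow> 'a freealg \<Rightarrow> 'a freealg" where
  "scal c x = Poly_Mapping.single [] c * x"

definition free_algebra :: "nat set \<Rightarrow> 'a::comm_ring_1 freealg ring" where
  "free_algebra G =
    \<lparr>carrier = {x. Poly_Mapping.keys x \<subseteq> lists G}, mult = (*), one = 1, zero = 0, add = (+)\<rparr>"

lemma ring_free_algebra: "ring (free_algebra G :: 'a::comm_ring_1 freealg ring)"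
proof (rule ringI)
  show "abelian_group (free_algebra G :: 'a freealg ring)"
  proof (rule abelian_groupI)
    fix x :: "'a freealg"
    assume "x \<in> carrier (free_algebra G)"
    then show "\<exists>y\<in>carrier (free_algebra G). y \<oplus>\<^bsub>free_algebra G\<^esub> x = \<zero>\<^bsub>free_algebra G\<^esub>"
      by (intro bexI[of _ "- x"]) (auto simp: free_algebra_def keys_minus)
  qed (use keys_add in \<open>force simp: free_algebra_def ac_simps\<close>)+
  show "Group.monoid (free_algebra G :: 'a freealg ring)"
  proof (rule monoidI)
    fix x y :: "'a freealg"
    assume "x \<in> carrier (free_algebra G)" "y \<in> carrier (free_algebra G)"
    then show "x \<otimes>\<^bsub>free_algebra G\<^esub> y \<in> carrier (free_algebra G)"
      using keys_mult[of x y] by (fastforce simp: free_algebra_def plus_list_def)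
  qed (auto simp: free_algebra_def mult.assoc zero_list_def)
qed (auto simp: free_algebra_def algebra_simps)


section \<open>The Iwahori-Hecke algebra of type A\<close>

text \<open>
  Throughout, \<open>q'\<close> stands for the inverse of \<open>q\<close>.  The letter \<open>i\<close> is the generator
  \<open>T\<^sub>i\<close>, for \<open>1 \<le> i \<le> r - 1\<close>.  A relation \<open>a = b\<close> is represented by \<open>a - b\<close>.
\<close>

definition hecke_relations :: "'a::comm_ring_1 \<Rightarrow> 'a \<Rightarrow> nat \<Rightarrow> 'a freealg set" where
  "hecke_relations q q' r =
     {word [i] * word [i] - (scal (q - q') (word [i]) + 1) | i. 1 \<le> i \<and> i < r}
   \<union> {word [i] * word [i+1] * word [i] - word [i+1] * word [i] * word [i+1] | i.
        1 \<le> i \<and> i + 1 < r}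
   \<union> {word [i] * word [j] - word [j] * word [i] | i j.
        1 \<le> i \<and> i < r \<and> 1 \<le> j \<and> j < r \<and> \<bar>int i - int j\<bar> > 1}"

definition hecke_ideal :: "'a::comm_ring_1 \<Rightarrow> 'a \<Rightarrow> nat \<Rightarrow> 'a freealg set" where
  "hecke_ideal q q' r = genideal (free_algebra {1..<r}) (hecke_relations q q' r)"

definition hecke_class :: "'a::comm_ring_1 \<Rightarrow> 'a \<Rightarrow> nat \<Rightarrow> 'a freealg \<Rightarrow> 'a freealg set" where
  "hecke_class q q' r x = hecke_ideal q q' r +>\<^bsub>free_algebra {1..<r}\<^esub> x"

text \<open>
  The quotient ring, as an \<open>R\<close>-algebra: a scalar acts through the structure map
  \<open>c \<mapsto> [c \<cdot> 1]\<close>.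
\<close>

definition hecke :: "'a::comm_ring_1 \<Rightarrow> 'a \<Rightarrow> nat \<Rightarrow> ('a, 'a freealg set) module" where
  "hecke q q' r =
    (let Q = free_algebra {1..<r} Quot hecke_ideal q q' r
     in \<lparr>carrier = carrier Q, mult = mult Q, one = one Q, zero = zero Q, add = add Q,
         smult = (\<lambda>c X. hecke_class q q' r (scal c 1) \<otimes>\<^bsub>Q\<^esub> X)\<rparr>)"

definition hecke_gen :: "'a::comm_ring_1 \<Rightarrow> 'a \<Rightarrow> nat \<Rightarrow> nat \<Rightarrow> 'a freealg set" where
  "hecke_gen q q' r i = hecke_class q q' r (word [i])"


section \<open>Tensor powers of a free module\<close>

text \<open>
  The \<open>r\<close>-th tensor power of the free module on \<open>v\<^sub>1, \<dots>, v\<^sub>N\<close> is the degree \<open>r\<close> component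
  of its tensor algebra, which is the free algebra on the letters \<open>1, \<dots>, N\<close>: the word
  \<open>[k\<^sub>1, \<dots>, k\<^sub>r]\<close> is the basis vector \<open>v\<^bsub>k\<^sub>1\<^esub> \<otimes> \<dots> \<otimes> v\<^bsub>k\<^sub>r\<^esub>\<close>, and \<open>x \<otimes> y\<close> is the product
  \<open>x * y\<close>.  The module itself is the first tensor power.
\<close>

definition tensor_words :: "nat \<Rightarrow> nat \<Rightarrow> nat list set" where
  "tensor_words N r = {w \<in> lists {1..N}. length w = r}"

definition tensor_power :: "nat \<Rightarrow> nat \<Rightarrow> 'a::comm_ring_1 freealg set" where
  "tensor_power N r = {x. Poly_Mapping.keys x \<subseteq> tensor_words N r}"

definition lin_on ::
  "'a::comm_ring_1 freealg set \<Rightarrow> ('a freealg \<Rightarrow> 'a freealg) \<Rightarrow> bool" where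
  "lin_on M f \<longleftrightarrow>
     (\<forall>x\<in>M. \<forall>y\<in>M. f (x + y) = f x + f y) \<and> (\<forall>c. \<forall>x\<in>M. f (scal c x) = scal c (f x))"

definition lin_ext ::
  "(nat list \<Rightarrow> 'a::comm_ring_1 freealg) \<Rightarrow> 'a freealg \<Rightarrow> 'a freealg" where
  "lin_ext b x = (\<Sum>w\<in>Poly_Mapping.keys x. scal (Poly_Mapping.lookup x w) (b w))"

text \<open>
  The tensor product of an operator \<open>f\<close> on the \<open>a\<close>-th and an operator \<open>g\<close> on the \<open>b\<close>-th
  tensor power, given on basis vectors \<open>u \<otimes> w\<close>.  See \<open>tensor_op_tensor\<close> below.
\<close>

definition tensor_op ::
  "nat \<Rightarrow> nat \<Rightarrow> ('a::comm_ring_1 freealg \<Rightarrow> 'a freealg) \<Rightarrow>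
   nat \<Rightarrow> ('a freealg \<Rightarrow> 'a freealg) \<Rightarrow> 'a freealg \<Rightarrow> 'a freealg" where
  "tensor_op N a f b g =
     restrict (lin_ext (\<lambda>w. f (word (take a w)) * g (word (drop a w)))) (tensor_power N (a + b))"

primrec tensor_op_power ::
  "nat \<Rightarrow> ('a::comm_ring_1 freealg \<Rightarrow> 'a freealg) \<Rightarrow> nat \<Rightarrow> 'a freealg \<Rightarrow> 'a freealg" where
  "tensor_op_power N f 0 = restrict id (tensor_power N 0)"
| "tensor_op_power N f (Suc k) = tensor_op N k (tensor_op_power N f k) 1 f"

lemma lookup_scal: "Poly_Mapping.lookup (scal c x) w = c * Poly_Mapping.lookup x w"
  by (simp add: scal_def zero_list_def[symmetric] mult_map_scale_conv_mult[symmetric]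
      map.rep_eq when_def)

lemma freealg_decompose:
  fixes x :: "'a::comm_ring_1 freealg"
  shows "x = (\<Sum>w\<in>Poly_Mapping.keys x. scal (Poly_Mapping.lookup x w) (word w))"
  by (rule poly_mapping_eqI)
    (simp add: lookup_sum lookup_scal word_def lookup_single when_def in_keys_iff
      if_distrib[of "\<lambda>t. _ * t"] cong: if_cong)

lemma single_Nil_commute: "x * Poly_Mapping.single [] c = Poly_Mapping.single [] c * x"
  for x :: "'a::comm_ring_1 freealg"
proof -
  have *: "scal d (word w) * Poly_Mapping.single [] c = Poly_Mapping.single [] c * scal d (word w)"
    for d :: 'a and w
    by (simp add: scal_def word_def mult_single plus_list_def mult.commute)
  show ?thesis
    by (subst (1 2) freealg_decompose[of x]) (simp only: sum_distrib_left sum_distrib_right *)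
qed

lemma scal_mult_left: "scal c x * y = scal c (x * y)"
  by (simp add: scal_def mult.assoc)

lemma scal_mult_right: "x * scal c y = scal c (x * y)"
  by (simp add: scal_def mult.assoc[symmetric] single_Nil_commute)

lemma scal_scal: "scal c (scal d x) = scal (c * d) x"
  by (simp add: scal_def mult.assoc[symmetric] mult_single plus_list_def)

lemma scal_sum: "scal c (sum g A) = (\<Sum>i\<in>A. scal c (g i))"
  by (simp add: scal_def sum_distrib_left)

lemma lin_ext_superset:
  assumes "finite A" "Poly_Mapping.keys x \<subseteq> A"
  shows "lin_ext b x = (\<Sum>w\<in>A. scal (Poly_Mapping.lookup x w) (b w))"
  unfolding lin_ext_def using assms
  by (intro sum.mono_neutral_left) (auto simp: in_keys_iff scal_def)

lemma lin_ext_add: "lin_ext b (x + y) = lin_ext b x + lin_ext b y"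
proof -
  define A where "A = Poly_Mapping.keys x \<union> Poly_Mapping.keys y"
  have "finite A" "Poly_Mapping.keys x \<subseteq> A" "Poly_Mapping.keys y \<subseteq> A"
      "Poly_Mapping.keys (x + y) \<subseteq> A"
    using keys_add[of x y] by (auto simp: A_def)
  then show ?thesis
    by (simp add: lin_ext_superset[of A] lookup_add scal_def single_add distrib_right sum.distrib)
qed

lemma lin_ext_scal: "lin_ext b (scal c x) = scal c (lin_ext b x)"
proof -
  have "Poly_Mapping.keys (scal c x) \<subseteq> Poly_Mapping.keys x"
    by (auto simp: in_keys_iff lookup_scal)
  then have "lin_ext b (scal c x) =
      (\<Sum>w\<in>Poly_Mapping.keys x. scal (Poly_Mapping.lookup (scal c x) w) (b w))"
    by (intro lin_ext_superset) auto
  then show ?thesis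
    by (simp add: lookup_scal lin_ext_def scal_sum scal_scal)
qed

lemma lin_ext_sum: "lin_ext b (sum g A) = (\<Sum>i\<in>A. lin_ext b (g i))"
  by (induction A rule: infinite_finite_induct) (simp_all add: lin_ext_add, simp_all add: lin_ext_def)

lemma lin_ext_word: "lin_ext b (word w) = b w"
  by (simp add: lin_ext_def word_def scal_def flip: zero_list_def)

lemma tensor_power_zero: "0 \<in> tensor_power N r"
  by (simp add: tensor_power_def)

lemma tensor_power_add:
  "x \<in> tensor_power N r \<Longrightarrow> y \<in> tensor_power N r \<Longrightarrow> x + y \<in> tensor_power N r"
  using keys_add[of x y] by (auto simp: tensor_power_def)

lemma tensor_power_scal: "x \<in> tensor_power N r \<Longrightarrow> scal c x \<in> tensor_power N r"
  unfolding tensor_power_def subset_iff mem_Collect_eq in_keys_iff lookup_scal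
  by (metis mult_zero_right)

lemma tensor_power_word:
  fixes x :: "'a::comm_ring_1 freealg"
  shows "x \<in> tensor_power N r \<Longrightarrow> w \<in> Poly_Mapping.keys x \<Longrightarrow>
    (word w :: 'a freealg) \<in> tensor_power N r"
  by (auto simp: tensor_power_def word_def)

lemma tensor_power_mult:
  "x \<in> tensor_power N a \<Longrightarrow> y \<in> tensor_power N b \<Longrightarrow> x * y \<in> tensor_power N (a + b)"
  using keys_mult[of x y]
  by (fastforce simp: tensor_power_def tensor_words_def plus_list_def)

lemma lin_on_eq_lin_ext:
  fixes x :: "'a::comm_ring_1 freealg"
  assumes f: "lin_on (tensor_power N r) f" and x: "x \<in> tensor_power N r"
  shows "f x = lin_ext (\<lambda>w. f (word w)) x"
proof -
  let ?M = "tensor_power N r :: 'a freealg set"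
  have f0: "f 0 = 0"
    using f tensor_power_zero[of N r] unfolding lin_on_def by (metis add_cancel_right_right)
  have "(\<Sum>i\<in>A. g i) \<in> ?M \<and> f (\<Sum>i\<in>A. g i) = (\<Sum>i\<in>A. f (g i))"
    if "finite A" "\<And>i. i \<in> A \<Longrightarrow> g i \<in> ?M" for A :: "nat list set" and g
    using that f
    by (induction A) (auto simp: f0 tensor_power_zero tensor_power_add lin_on_def)
  from this[of "Poly_Mapping.keys x" "\<lambda>w. scal (Poly_Mapping.lookup x w) (word w)"]
  have "f (\<Sum>w\<in>Poly_Mapping.keys x. scal (Poly_Mapping.lookup x w) (word w)) =
      (\<Sum>w\<in>Poly_Mapping.keys x. f (scal (Poly_Mapping.lookup x w) (word w)))"
    using tensor_power_scal[OF tensor_power_word[OF x]] finite_keys[of x] by blast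
  also have "\<dots> = lin_ext (\<lambda>w. f (word w)) x"
    unfolding lin_ext_def using f x tensor_power_word[OF x]
    by (intro sum.cong refl) (auto simp: lin_on_def)
  finally show ?thesis by (simp flip: freealg_decompose)
qed

lemma tensor_op_tensor:
  fixes x y :: "'a::comm_ring_1 freealg"
  assumes f: "lin_on (tensor_power N a) f" and g: "lin_on (tensor_power N b) g"
    and x: "x \<in> tensor_power N a" and y: "y \<in> tensor_power N b"
  shows "tensor_op N a f b g (x * y) = f x * g y"
proof -
  let ?b = "\<lambda>w. f (word (take a w)) * g (word (drop a w))"
  have wm: "word u * word w = (word (u @ w) :: 'a freealg)" for u w
    by (simp add: word_def mult_single plus_list_def)
  have "x * y = (\<Sum>u\<in>Poly_Mapping.keys x. \<Sum>w\<in>Poly_Mapping.keys y.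
      scal (Poly_Mapping.lookup x u) (scal (Poly_Mapping.lookup y w) (word (u @ w))))"
    by (subst freealg_decompose[of x], subst freealg_decompose[of y])
      (simp add: sum_product scal_mult_left scal_mult_right wm scal_scal mult.commute)
  then have "lin_ext ?b (x * y) = (\<Sum>u\<in>Poly_Mapping.keys x. \<Sum>w\<in>Poly_Mapping.keys y.
      scal (Poly_Mapping.lookup x u) (scal (Poly_Mapping.lookup y w) (?b (u @ w))))"
    by (simp only: lin_ext_sum lin_ext_scal lin_ext_word)
  also have "\<dots> = (\<Sum>u\<in>Poly_Mapping.keys x. \<Sum>w\<in>Poly_Mapping.keys y.
      scal (Poly_Mapping.lookup x u) (scal (Poly_Mapping.lookup y w) (f (word u) * g (word w))))"
    using x by (intro sum.cong refl) (auto simp: tensor_power_def tensor_words_def)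
  also have "\<dots> = lin_ext (\<lambda>w. f (word w)) x * lin_ext (\<lambda>w. g (word w)) y"
    by (simp add: lin_ext_def sum_product scal_mult_left scal_mult_right scal_scal mult.commute)
  also have "\<dots> = f x * g y"
    using lin_on_eq_lin_ext[OF f x] lin_on_eq_lin_ext[OF g y] by simp
  finally show ?thesis
    using tensor_power_mult[OF x y] by (simp add: tensor_op_def)
qed


section \<open>Right representations\<close>

text \<open>
  Operators are written on the right of their arguments, so the product of \<open>f\<close> and \<open>g\<close> in the
  endomorphism algebra first applies \<open>f\<close>.
\<close>

definition right_End ::
  "'a::comm_ring_1 freealg set \<Rightarrow> ('a, 'a freealg \<Rightarrow> 'a freealg) module" where
  "right_End M =
    \<lparr>carrier = {f \<in> M \<rightarrow>\<^sub>E M. lin_on M f},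
     mult = (\<lambda>f g. compose M g f),
     one = restrict id M,
     zero = (\<lambda>x\<in>M. 0),
     add = (\<lambda>f g. \<lambda>x\<in>M. f x + g x),
     smult = (\<lambda>c f. \<lambda>x\<in>M. scal c (f x))\<rparr>"

definition algebra_hom ::
  "('a, 'b, 'c) module_scheme \<Rightarrow> ('a, 'd, 'e) module_scheme \<Rightarrow> ('b \<Rightarrow> 'd) set" where
  "algebra_hom A B =
     {h \<in> ring_hom A B. \<forall>c. \<forall>x\<in>carrier A. h (c \<odot>\<^bsub>A\<^esub> x) = c \<odot>\<^bsub>B\<^esub> h x}"

text \<open>Restricting to extensional functions makes equality of representations meaningful.\<close>

definition right_representation ::
  "('a::comm_ring_1, 'b) module \<Rightarrow> 'a freealg set \<Rightarrow>
   ('b \<Rightarrow> 'a freealg \<Rightarrow> 'a freealg) \<Rightarrow> bool" where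
  "right_representation A M \<rho> \<longleftrightarrow>
     \<rho> \<in> algebra_hom A (right_End M) \<and> \<rho> \<in> extensional (carrier A)"


section \<open>The operator \<open>T\<close>\<close>

text \<open>
  The basis vectors \<open>v\<^sub>1, \<dots>, v\<^sub>m\<close> are even and \<open>v\<^bsub>m+1\<^esub>, \<dots>, v\<^bsub>m+n\<^esub>\<close> are odd.
\<close>

definition parity :: "nat \<Rightarrow> nat \<Rightarrow> nat" where
  "parity m k = (if k \<le> m then 0 else 1)"

definition T_basis :: "'a::comm_ring_1 \<Rightarrow> 'a \<Rightarrow> nat \<Rightarrow> nat \<Rightarrow> nat \<Rightarrow> 'a freealg" where
  "T_basis q q' m k l =
    (if k = l then scal (if parity m k = 0 then q else - q') (word [k, l])
     else if k < l then
       scal ((- 1) ^ (parity m k * parity m l)) (word [l, k]) + scal (q - q') (word [k, l])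
     else scal ((- 1) ^ (parity m k * parity m l)) (word [l, k]))"

definition T_op ::
  "'a::comm_ring_1 \<Rightarrow> 'a \<Rightarrow> nat \<Rightarrow> nat \<Rightarrow> 'a freealg \<Rightarrow> 'a freealg" where
  "T_op q q' m n =
     restrict (lin_ext (\<lambda>w. T_basis q q' m (w ! 0) (w ! 1))) (tensor_power (m + n) 2)"

definition T_at ::
  "'a::comm_ring_1 \<Rightarrow> 'a \<Rightarrow> nat \<Rightarrow> nat \<Rightarrow> nat \<Rightarrow> nat \<Rightarrow> 'a freealg \<Rightarrow> 'a freealg" where
  "T_at q q' m n r i =
    (let N = m + n; Id = restrict id (tensor_power N 1)
     in tensor_op N (i + 1)
          (tensor_op N (i - 1) (tensor_op_power N Id (i - 1)) 2 (T_op q q' m n))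
          (r - i - 1) (tensor_op_power N Id (r - i - 1)))"

end

theory Submission
  imports Defs
begin

text \<open>
  The operator \<open>T\<close> in positions \<open>i, i + 1\<close> only sees the corresponding two tensor factors, so the
  quadratic and braid relations reduce to tensors of two and three basis vectors.  There, up to
  scalars, \<open>T\<close> is the sum of a swap and a diagonal term, and the relations are identities between
  the coefficients for each relative order of the indices, using only that the swap signs are
  symmetric and square to \<open>1\<close> and that the diagonal coefficient for equal indices is a root of
  \<open>X\<^sup>2 - (q - q')X - 1\<close>.  Hence the action of the free algebra kills the Hecke ideal
  and descends to the quotient; it is determined by the generators because words span the free
  algebra.
\<close>

section \<open>Linear combinations of words\<close>

lemma scal_add_right: "scal c (x + y) = scal c x + scal c y"
  by (simp add: scal_def distrib_left)

lemma scal_zero [simp]: "scal c 0 = 0" "scal 0 x = 0"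
  by (simp_all add: scal_def)

lemma scal_one [simp]: "scal 1 x = x"
  by (simp add: scal_def flip: zero_list_def)

lemma word_mult: "word u * word w = word (u @ w)"
  by (simp add: word_def mult_single plus_list_def)

lemma word_Nil: "word [] = 1"
  by (simp add: word_def flip: zero_list_def)

lemma lin_ext_zero [simp]: "lin_ext b 0 = 0"
  by (simp add: lin_ext_def)

lemma lin_ext_diff: "lin_ext b (x - y) = lin_ext b x - lin_ext b y"
  by (metis add_diff_cancel_right' diff_add_cancel lin_ext_add)

lemmas lin_ext_simps = lin_ext_add lin_ext_diff lin_ext_scal lin_ext_word

lemma lin_ext_cong:
  "(\<And>w. w \<in> Poly_Mapping.keys x \<Longrightarrow> f w = g w) \<Longrightarrow> lin_ext f x = lin_ext g x"
  by (simp add: lin_ext_def)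

lemma lin_ext_word_id: "lin_ext word x = x"
  by (simp add: lin_ext_def flip: freealg_decompose)

lemma keys_word: "Poly_Mapping.keys (word w :: 'a::comm_ring_1 freealg) = {w}"
  by (simp add: word_def)

lemma keys_scal: "Poly_Mapping.keys (scal c x) \<subseteq> Poly_Mapping.keys x"
  by (auto simp: in_keys_iff lookup_scal)

lemma freealg_induct [consumes 1, case_names zero add basis]:
  fixes x :: "'a::comm_ring_1 freealg"
  assumes "Poly_Mapping.keys x \<subseteq> W"
    and "P 0"
    and add: "\<And>x y. Poly_Mapping.keys x \<subseteq> W \<Longrightarrow> Poly_Mapping.keys y \<subseteq> W \<Longrightarrow> P x \<Longrightarrow> P y \<Longrightarrow> P (x + y)"
    and basis: "\<And>c w. w \<in> W \<Longrightarrow> P (scal c (word w))"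
  shows "P x"
proof -
  \<comment> \<open>The support bound is proved together with \<open>P\<close>, because
    \<open>add\<close> asks for it on each partial sum.\<close>
  have "Poly_Mapping.keys (\<Sum>w\<in>A. scal (f w) (word w)) \<subseteq> W \<and> P (\<Sum>w\<in>A. scal (f w) (word w))"
    if "finite A" "A \<subseteq> W" for A and f :: "nat list \<Rightarrow> 'a"
    using that
  proof (induction A)
    case (insert w A)
    have *: "Poly_Mapping.keys (scal (f w) (word w)) \<subseteq> W"
      using keys_scal[of "f w" "word w"] insert.prems by (auto simp: keys_word)
    have "Poly_Mapping.keys (scal (f w) (word w) + (\<Sum>w\<in>A. scal (f w) (word w))) \<subseteq> W"
      by (rule order_trans[OF keys_add Un_least[OF *]]) (use insert in simp)
    then show ?case
      using insert * add basis by simp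
  qed (simp add: assms(2))
  from this[of "Poly_Mapping.keys x" "Poly_Mapping.lookup x"] show ?thesis
    using assms(1) by (simp flip: freealg_decompose)
qed

lemma tensor_power_sum:
  "(\<And>i. i \<in> A \<Longrightarrow> g i \<in> tensor_power N r) \<Longrightarrow> sum g A \<in> tensor_power N r"
  by (induction A rule: infinite_finite_induct) (auto simp: tensor_power_zero tensor_power_add)

lemma lin_ext_tensor_power:
  "x \<in> tensor_power N r \<Longrightarrow> (\<And>w. w \<in> tensor_words N r \<Longrightarrow> b w \<in> tensor_power N s) \<Longrightarrow>
    lin_ext b x \<in> tensor_power N s"
  unfolding lin_ext_def by (intro tensor_power_sum tensor_power_scal) (auto simp: tensor_power_def)

lemma word_in_tensor_power:
  "word w \<in> (tensor_power N r :: 'a::comm_ring_1 freealg set) \<longleftrightarrow> w \<in> tensor_words N r"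
  by (simp add: tensor_power_def keys_word)

text \<open>On a basis word the two factors return \<open>take k w\<close> and
  \<open>drop k w\<close>, whose concatenation is \<open>w\<close> again. This removes the outer
  identity powers from \<open>T_at\<close>.\<close>

lemma tensor_op_power_id:
  "tensor_op_power N (restrict id (tensor_power N 1)) k =
    (restrict id (tensor_power N k) :: 'a::comm_ring_1 freealg \<Rightarrow> 'a freealg)"
proof (induction k)
  case (Suc k)
  have "lin_ext (\<lambda>w. restrict id (tensor_power N k) (word (take k w)) *
      restrict id (tensor_power N 1) (word (drop k w))) x = x"
    if "x \<in> tensor_power N (Suc k)" for x :: "'a freealg"
  proof -
    have "lin_ext (\<lambda>w. restrict id (tensor_power N k) (word (take k w)) *
        restrict id (tensor_power N 1) (word (drop k w))) x = lin_ext word x"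
    proof (rule lin_ext_cong)
      fix w assume "w \<in> Poly_Mapping.keys x"
      with that have "w \<in> tensor_words N (Suc k)" by (auto simp: tensor_power_def)
      then have "take k w \<in> tensor_words N k" "drop k w \<in> tensor_words N 1"
        by (auto simp: tensor_words_def dest: in_set_takeD in_set_dropD)
      then show "restrict id (tensor_power N k) (word (take k w)) *
          restrict id (tensor_power N 1) (word (drop k w)) = (word w :: 'a freealg)"
        by (simp add: word_in_tensor_power word_mult)
    qed
    then show ?thesis by (simp add: lin_ext_word_id)
  qed
  then show ?case
    unfolding tensor_op_power.simps Suc.IH tensor_op_def Suc_eq_plus1[symmetric]
    by (intro restrict_ext) (simp only: id_apply)
qed (simp add: restrict_def fun_eq_iff)

section \<open>The operator in a given position\<close>

text \<open>
  Positions are counted from \<open>0\<close>, so \<open>T\<^sub>i\<close> acts as \<open>T_shift\<close> at position \<open>i - 1\<close>.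
\<close>

definition T_shift :: "'a::comm_ring_1 \<Rightarrow> 'a \<Rightarrow> nat \<Rightarrow> nat \<Rightarrow> 'a freealg \<Rightarrow> 'a freealg" where
  "T_shift q q' m j =
    lin_ext (\<lambda>w. word (take j w) * T_basis q q' m (w ! j) (w ! (j + 1)) * word (drop (j + 2) w))"

lemma T_shift_simps:
  "T_shift q q' m j 0 = 0"
  "T_shift q q' m j (x + y) = T_shift q q' m j x + T_shift q q' m j y"
  "T_shift q q' m j (scal c x) = scal c (T_shift q q' m j x)"
  by (simp_all add: T_shift_def lin_ext_simps)

text \<open>
  For equal indices the swap is trivial, and the whole coefficient is counted as diagonal.
\<close>

definition T_swap :: "nat \<Rightarrow> nat \<Rightarrow> nat \<Rightarrow> 'a::comm_ring_1" where
  "T_swap m k l = (if k = l then 0 else (- 1) ^ (parity m k * parity m l))"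

definition T_diag :: "'a::comm_ring_1 \<Rightarrow> 'a \<Rightarrow> nat \<Rightarrow> nat \<Rightarrow> nat \<Rightarrow> 'a" where
  "T_diag q q' m k l =
    (if k = l then if parity m k = 0 then q else - q' else if k < l then q - q' else 0)"

text \<open>One formula for all relative orders of \<open>k\<close> and \<open>l\<close>: operators
  can be composed first, and cases are distinguished only for the coefficients.\<close>

lemma T_basis_eq:
  "T_basis q q' m k l = scal (T_swap m k l) (word [l, k]) + scal (T_diag q q' m k l) (word [k, l])"
  by (simp add: T_basis_def T_swap_def T_diag_def)

lemma T_basis_tensor_power:
  fixes q q' :: "'a::comm_ring_1"
  assumes "k \<in> {1..N}" "l \<in> {1..N}"
  shows "T_basis q q' m k l \<in> tensor_power N 2"
proof -
  have "word [k, l] \<in> (tensor_power N 2 :: 'a freealg set)"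
    "word [l, k] \<in> (tensor_power N 2 :: 'a freealg set)"
    using assms by (simp_all add: word_in_tensor_power tensor_words_def)
  then show ?thesis
    by (simp add: T_basis_eq tensor_power_add tensor_power_scal)
qed

lemma T_shift_tensor_power:
  assumes "x \<in> tensor_power N r" "j + 2 \<le> r"
  shows "T_shift q q' m j x \<in> tensor_power N r"
  unfolding T_shift_def
proof (rule lin_ext_tensor_power[OF assms(1)])
  fix w assume w: "w \<in> tensor_words N r"
  then have "set w \<subseteq> {1..N}" "length w = r" by (auto simp: tensor_words_def)
  then have "w ! j \<in> {1..N}" "w ! (j + 1) \<in> {1..N}"
    using assms(2) by (metis nth_mem subsetD add_2_eq_Suc' Suc_eq_plus1 Suc_le_eq Suc_lessD)+
  moreover have "take j w \<in> tensor_words N j" "drop (j + 2) w \<in> tensor_words N (r - (j + 2))"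
    using w assms(2) by (auto simp: tensor_words_def dest: in_set_takeD in_set_dropD)
  ultimately have "word (take j w) * T_basis q q' m (w ! j) (w ! (j + 1)) * word (drop (j + 2) w)
      \<in> tensor_power N (j + 2 + (r - (j + 2)))"
    by (intro tensor_power_mult T_basis_tensor_power) (simp_all only: word_in_tensor_power)
  then show "word (take j w) * T_basis q q' m (w ! j) (w ! (j + 1)) * word (drop (j + 2) w)
      \<in> tensor_power N r" by (simp only: le_add_diff_inverse[OF assms(2)])
qed

text \<open>Since \<open>k + 2 \<le> b\<close>, the two letters acted on lie inside
  \<open>x\<close>. All terms are linear in each of \<open>u\<close>, \<open>x\<close> and
  \<open>v\<close>, so three nested inductions reduce the claim to words.\<close>

lemma T_shift_local:
  assumes "u \<in> tensor_power N a" "x \<in> tensor_power N b" "k + 2 \<le> b"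
  shows "T_shift q q' m (a + k) (u * x * v) = u * T_shift q q' m k x * v"
proof -
  \<comment> \<open>Letter \<open>a + k\<close> of the concatenated word is letter \<open>k\<close>
    of \<open>x\<close>, and likewise for its successor.\<close>
  have w: "T_shift q q' m (a + k) (word u * word x * word v) = word u * T_shift q q' m k (word x) * word v"
    if "length u = a" "length x = b" for u x v
    using that assms(3)
    by (simp add: word_mult T_shift_def lin_ext_word nth_append mult.assoc add.assoc)
      (simp add: word_mult mult.assoc[symmetric])
  have "Poly_Mapping.keys u \<subseteq> {w. length w = a}"
    using assms(1) by (auto simp: tensor_power_def tensor_words_def)
  then show ?thesis
  proof (induction u rule: freealg_induct)
    case (basis c u)
    have "Poly_Mapping.keys x \<subseteq> {w. length w = b}"
      using assms(2) by (auto simp: tensor_power_def tensor_words_def)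
    then show ?case
    proof (induction x rule: freealg_induct)
      case (basis d x)
      have "Poly_Mapping.keys v \<subseteq> UNIV" by simp
      then show ?case
        by (induction v rule: freealg_induct)
          (use \<open>u \<in> _\<close> basis in \<open>simp_all add: T_shift_simps distrib_left scal_mult_left scal_mult_right w\<close>)
    qed (simp_all add: T_shift_simps distrib_left distrib_right)
  qed (simp_all add: T_shift_simps distrib_right)
qed

text \<open>On a basis word the nested tensor operators copy the first \<open>i - 1\<close> and the
  last \<open>r - i - 1\<close> letters and apply \<open>T_basis\<close> to the two between.\<close>

lemma T_at_eq:
  fixes q q' :: "'a::comm_ring_1"
  assumes "1 \<le> i" "i < r"
  shows "T_at q q' m n r i = restrict (T_shift q q' m (i - 1)) (tensor_power (m + n) r)"
proof -
  let ?N = "m + n"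
  let ?A = "\<lambda>k. tensor_power ?N k :: 'a freealg set"
  \<comment> \<open>\<open>j\<close> and \<open>k\<close> count the identity factors to the left and
    to the right of \<open>T\<close>; they remove the truncated subtractions.\<close>
  obtain j where j: "i = Suc j" using assms by (cases i) auto
  obtain k where k: "r = j + 2 + k" using assms j less_iff_Suc_add[of i r] by auto
  have inner: "tensor_op ?N j (restrict id (?A j)) 2 (T_op q q' m n) (word w) =
      word (take j w) * T_basis q q' m (w ! j) (w ! (j + 1))" if "w \<in> tensor_words ?N (j + 2)" for w
  proof -
    have "take j w \<in> tensor_words ?N j" "drop j w \<in> tensor_words ?N 2"
      using that by (auto simp: tensor_words_def dest: in_set_takeD in_set_dropD)
    then show ?thesis using that
      by (simp add: tensor_op_def T_op_def lin_ext_word word_in_tensor_power)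
         (simp add: tensor_words_def)
  qed
  have "T_at q q' m n r i x = restrict (T_shift q q' m (i - 1)) (?A r) x" for x
  proof (cases "x \<in> ?A r")
    case True
    have "lin_ext (\<lambda>w. tensor_op ?N j (restrict id (?A j)) 2 (T_op q q' m n) (word (take (j + 2) w)) *
        restrict id (?A k) (word (drop (j + 2) w))) x = T_shift q q' m j x"
      unfolding T_shift_def
    proof (rule lin_ext_cong)
      fix w assume "w \<in> Poly_Mapping.keys x"
      with True have w: "w \<in> tensor_words ?N r" by (auto simp: tensor_power_def)
      then have "take (j + 2) w \<in> tensor_words ?N (j + 2)"
        "drop (j + 2) w \<in> tensor_words ?N k"
        using k by (auto simp: tensor_words_def dest: in_set_takeD in_set_dropD)
      then show "tensor_op ?N j (restrict id (?A j)) 2 (T_op q q' m n) (word (take (j + 2) w)) *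
          restrict id (?A k) (word (drop (j + 2) w)) =
          word (take j w) * T_basis q q' m (w ! j) (w ! (j + 1)) * word (drop (j + 2) w)"
        by (simp add: inner word_in_tensor_power min_def)
    qed
    then show ?thesis using True j k
      by (simp add: T_at_def Let_def tensor_op_power_id[simplified] tensor_op_def[of _ "Suc (Suc j)"])
  \<comment> \<open>Outside the tensor power both restricted functions are
    \<open>undefined\<close>.\<close>
  qed (use j k in \<open>simp add: T_at_def Let_def tensor_op_def\<close>)
  then show ?thesis by blast
qed

section \<open>The Hecke relations\<close>

lemma T_swap_commute: "T_swap m k l = T_swap m l k"
  by (simp add: T_swap_def mult.commute)

lemma T_swap_square: "k \<noteq> l \<Longrightarrow> T_swap m k l * T_swap m k l = (1 :: 'a::comm_ring_1)"
  by (simp add: T_swap_def parity_def)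

lemma T_shift_two: "T_shift q q' m 0 (word [a, b]) =
    scal (T_swap m a b) (word [b, a]) + scal (T_diag q q' m a b) (word [a, b])"
  by (simp add: T_shift_def lin_ext_word T_basis_eq word_Nil)

lemma T_shift_three:
  "T_shift q q' m 0 (word [a, b, c]) =
    scal (T_swap m a b) (word [b, a, c]) + scal (T_diag q q' m a b) (word [a, b, c])"
  "T_shift q q' m 1 (word [a, b, c]) =
    scal (T_swap m b c) (word [a, c, b]) + scal (T_diag q q' m b c) (word [a, b, c])"
  by (simp_all add: T_shift_def lin_ext_word T_basis_eq word_Nil distrib_left distrib_right
      scal_mult_left scal_mult_right word_mult)

lemma T_diag_less: "k < l \<Longrightarrow> T_diag q q' m k l = q - q'" "k < l \<Longrightarrow> T_diag q q' m l k = 0"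
  by (simp_all add: T_diag_def)

lemma T_swap_same: "T_swap m k k = 0"
  by (simp add: T_swap_def)

lemma T_swap_square_left: "k \<noteq> l \<Longrightarrow> T_swap m k l * (T_swap m k l * x) = (x :: 'a::comm_ring_1)"
  using T_swap_square[of k l m, where 'a='a] by (simp flip: mult.assoc)

text \<open>The possible values \<open>q\<close> and \<open>- q'\<close> have sum
  \<open>q - q'\<close> and product \<open>- 1\<close>. The second form carries a further factor so
  that rewriting also works inside right-nested products.\<close>

lemma T_diag_same_square:
  assumes "q * q' = 1"
  shows "T_diag q q' m k k * T_diag q q' m k k =
      q * T_diag q q' m k k - q' * T_diag q q' m k k + 1" (is ?A)
    and "T_diag q q' m k k * (T_diag q q' m k k * x) =
      q * (T_diag q q' m k k * x) - q' * (T_diag q q' m k k * x) + x"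
proof -
  show *: ?A
    using assms by (simp add: T_diag_def algebra_simps)
  show "T_diag q q' m k k * (T_diag q q' m k k * x) =
      q * (T_diag q q' m k k * x) - q' * (T_diag q q' m k k * x) + x"
    using arg_cong[OF *, of "\<lambda>y. y * x"] by (simp add: algebra_simps)
qed

text \<open>For \<open>a \<noteq> b\<close> the coefficient of \<open>[b, a]\<close> agrees because
  the diagonal terms of \<open>(a, b)\<close> and \<open>(b, a)\<close> add up to
  \<open>q - q'\<close>, and that of \<open>[a, b]\<close> because the swap squares to
  \<open>1\<close> and the diagonal term is \<open>0\<close> or \<open>q - q'\<close>. For
  \<open>a = b\<close> the root equation remains.\<close>

lemma T_shift_quadratic_two:
  fixes q q' :: "'a::comm_ring_1"
  assumes "q * q' = 1"
  shows "T_shift q q' m 0 (T_shift q q' m 0 (word [a, b])) =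
    scal (q - q') (T_shift q q' m 0 (word [a, b])) + word [a, b]"
proof (rule poly_mapping_eqI)
  fix v
  show "Poly_Mapping.lookup (T_shift q q' m 0 (T_shift q q' m 0 (word [a, b]))) v =
    Poly_Mapping.lookup (scal (q - q') (T_shift q q' m 0 (word [a, b])) + word [a, b]) v"
    unfolding T_shift_two T_shift_simps lookup_add lookup_scal T_swap_commute[of m b a]
    by (cases a b rule: linorder_cases)
      (simp_all add: T_diag_less T_swap_same T_swap_square T_swap_square_left
        T_diag_same_square[OF assms] algebra_simps)
qed

text \<open>The swap factor vanishes for equal indices, so in the first identity
  \<open>a \<noteq> b\<close> may be assumed. If \<open>a < b\<close>, then
  \<open>T_diag q q' m b c\<close> is \<open>0\<close> unless \<open>b \<le> c\<close>, and in that
  case \<open>a < c\<close> makes \<open>T_diag q q' m a c\<close> equal to \<open>q - q'\<close>.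
  The other orders follow from transitivity in the same way.\<close>

lemma braid_coefficients:
  fixes q q' :: "'a::comm_ring_1"
  shows "T_swap m a b *
      (T_diag q q' m a c * T_diag q q' m b a + T_diag q q' m a b * T_diag q q' m b c) =
      T_swap m a b * (T_diag q q' m b c * T_diag q q' m a c)"
    and "T_swap m b c *
      (T_diag q q' m a c * T_diag q q' m c b + T_diag q q' m b c * T_diag q q' m a b) =
      T_swap m b c * (T_diag q q' m a b * T_diag q q' m a c)"
proof -
  have "T_diag q q' m a c * T_diag q q' m b a + T_diag q q' m a b * T_diag q q' m b c =
      T_diag q q' m b c * T_diag q q' m a c" if "a \<noteq> b"
    using that by (cases a b rule: linorder_cases) (auto simp: T_diag_def)
  then show "T_swap m a b *
      (T_diag q q' m a c * T_diag q q' m b a + T_diag q q' m a b * T_diag q q' m b c) =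
      T_swap m a b * (T_diag q q' m b c * T_diag q q' m a c)"
    by (cases "a = b") (simp_all add: T_swap_same)
  have "T_diag q q' m a c * T_diag q q' m c b + T_diag q q' m b c * T_diag q q' m a b =
      T_diag q q' m a b * T_diag q q' m a c" if "b \<noteq> c"
    using that by (cases b c rule: linorder_cases) (auto simp: T_diag_def)
  then show "T_swap m b c *
      (T_diag q q' m a c * T_diag q q' m c b + T_diag q q' m b c * T_diag q q' m a b) =
      T_swap m b c * (T_diag q q' m a b * T_diag q q' m a c)"
    by (cases "b = c") (simp_all add: T_swap_same)
qed

text \<open>For distinct indices a diagonal term \<open>d\<close> satisfies
  \<open>d * d = (q - q') * d\<close>. If both neighbouring pairs are distinct, the swap squares
  contribute the same summand to both sides and this identity settles the rest; if exactly one pair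
  is equal, it is combined with the root equation.\<close>

lemma braid_diagonal_coefficient:
  fixes q q' :: "'a::comm_ring_1"
  assumes "q * q' = 1"
  shows "T_swap m a b * T_swap m a b * T_diag q q' m a c +
        T_diag q q' m a b * T_diag q q' m a b * T_diag q q' m b c =
      T_swap m b c * T_swap m b c * T_diag q q' m a c +
        T_diag q q' m b c * T_diag q q' m b c * T_diag q q' m a b"
proof -
  have d: "T_diag q q' m k l = 0 \<or> T_diag q q' m k l = q - q'" if "k \<noteq> l" for k l
    using that by (simp add: T_diag_def)
  note simps = T_swap_same T_swap_square T_diag_same_square(1)[OF assms] ring_distribs
  consider "a = b" "b = c" | "a = b" "b \<noteq> c" | "a \<noteq> b" "b = c" | "a \<noteq> b" "b \<noteq> c"
    by blast
  then show ?thesis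
  proof cases
    case 1
    then show ?thesis by simp
  next
    case 2
    then show ?thesis using d[OF \<open>b \<noteq> c\<close>] by (elim disjE) (simp_all add: simps)
  next
    case 3
    then show ?thesis using d[OF \<open>a \<noteq> b\<close>] by (elim disjE) (simp_all add: simps)
  next
    case 4
    then show ?thesis using d[OF \<open>a \<noteq> b\<close>] d[OF \<open>b \<noteq> c\<close>] by (elim disjE) (simp_all add: T_swap_square)
  qed
qed

lemma T_shift_braid_three:
  fixes q q' :: "'a::comm_ring_1"
  assumes "q * q' = 1"
  shows "T_shift q q' m 0 (T_shift q q' m 1 (T_shift q q' m 0 (word [a, b, c]))) =
    T_shift q q' m 1 (T_shift q q' m 0 (T_shift q q' m 1 (word [a, b, c])))"
proof -
  let ?S = "T_swap m :: nat \<Rightarrow> nat \<Rightarrow> 'a" and ?D = "T_diag q q' m"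
  \<comment> \<open>Both sides are expanded over the six rearrangements of \<open>[a, b, c]\<close>.
    The first three coefficients already agree; the other three are the subject of the preceding
    lemmas.\<close>
  have "T_shift q q' m 0 (T_shift q q' m 1 (T_shift q q' m 0 (word [a, b, c]))) =
      scal (?S a b * ?S a c * ?S b c) (word [c, b, a]) +
      scal (?S a b * ?S a c * ?D b c) (word [b, c, a]) +
      scal (?S a c * ?S b c * ?D a b) (word [c, a, b]) +
      scal (?S a b * (?D a c * ?D b a + ?D a b * ?D b c)) (word [b, a, c]) +
      scal (?S b c * (?D a b * ?D a c)) (word [a, c, b]) +
      scal (?S a b * ?S a b * ?D a c + ?D a b * ?D a b * ?D b c) (word [a, b, c])"
    unfolding T_shift_three T_shift_simps T_swap_commute[of m b a]
    \<comment> \<open>Comparing coefficients at an arbitrary word remains valid when some of the six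
      words coincide.\<close>
    by (rule poly_mapping_eqI) (simp add: lookup_add lookup_scal algebra_simps)
  also have "\<dots> =
      scal (?S a b * ?S a c * ?S b c) (word [c, b, a]) +
      scal (?S a b * ?S a c * ?D b c) (word [b, c, a]) +
      scal (?S a c * ?S b c * ?D a b) (word [c, a, b]) +
      scal (?S a b * (?D b c * ?D a c)) (word [b, a, c]) +
      scal (?S b c * (?D a c * ?D c b + ?D b c * ?D a b)) (word [a, c, b]) +
      scal (?S b c * ?S b c * ?D a c + ?D b c * ?D b c * ?D a b) (word [a, b, c])"
    by (simp only: braid_coefficients
        braid_diagonal_coefficient[OF assms, of m a b c])
  also have "\<dots> = T_shift q q' m 1 (T_shift q q' m 0 (T_shift q q' m 1 (word [a, b, c])))"
    unfolding T_shift_three T_shift_simps T_swap_commute[of m c b]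
    by (rule poly_mapping_eqI) (simp add: lookup_add lookup_scal algebra_simps)
  finally show ?thesis .
qed

section \<open>Transfer to arbitrary tensor powers\<close>

lemma tensor_words_split:
  assumes "w \<in> tensor_words N (a + b)"
  obtains u v where "w = u @ v" "u \<in> tensor_words N a" "v \<in> tensor_words N b"
proof
  show "w = take a w @ drop a w" by simp
qed (use assms in \<open>auto simp: tensor_words_def dest: in_set_takeD in_set_dropD\<close>)

lemma tensor_words_split3:
  assumes "w \<in> tensor_words N (a + b + c)"
  obtains u p v where "w = u @ p @ v" "u \<in> tensor_words N a" "p \<in> tensor_words N b"
    "v \<in> tensor_words N c"
proof -
  have "w \<in> tensor_words N (a + (b + c))"
    using assms by (simp only: add.assoc)
  then obtain u y where "w = u @ y" "u \<in> tensor_words N a" "y \<in> tensor_words N (b + c)"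
    by (rule tensor_words_split)
  moreover from this(3) obtain p v where "y = p @ v" "p \<in> tensor_words N b" "v \<in> tensor_words N c"
    by (rule tensor_words_split)
  ultimately show ?thesis using that by simp
qed

lemma tensor_power_induct [consumes 1, case_names zero add basis]:
  fixes x :: "'a::comm_ring_1 freealg"
  assumes "x \<in> tensor_power N r"
    and "P 0" "\<And>x y. P x \<Longrightarrow> P y \<Longrightarrow> P (x + y)"
    and "\<And>c w. w \<in> tensor_words N r \<Longrightarrow> P (scal c (word w))"
  shows "P x"
  using assms(1)[unfolded tensor_power_def mem_Collect_eq]
  by (induction x rule: freealg_induct) (use assms in auto)

text \<open>By linearity a basis word suffices; it is cut around the two active letters, and
  locality moves the claim to the middle piece.\<close>

lemma T_shift_quadratic:
  fixes q q' :: "'a::comm_ring_1"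
  assumes "q * q' = 1" "x \<in> tensor_power N r" "j + 2 \<le> r"
  shows "T_shift q q' m j (T_shift q q' m j x) = scal (q - q') (T_shift q q' m j x) + x"
  using assms(2)
proof (induction x rule: tensor_power_induct)
  case (basis c w)
  have "w \<in> tensor_words N (j + 2 + (r - (j + 2)))"
    using basis assms(3) by (simp only: le_add_diff_inverse)
  then obtain u p v where w: "w = u @ p @ v" "u \<in> tensor_words N j" "p \<in> tensor_words N 2"
    by (rule tensor_words_split3)
  have ww: "word w = word u * word p * (word v :: 'a freealg)"
    using w(1) by (simp add: word_mult)
  obtain a b where p: "p = [a, b]"
    using w(3) by (auto simp: tensor_words_def numeral_2_eq_2 length_Suc_conv)
  have loc: "T_shift q q' m j (word u * y * word v) = word u * T_shift q q' m 0 y * word v"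
    if "y \<in> tensor_power N 2" for y
    using T_shift_local[of "word u" N j y 2 0] w that by (simp add: word_in_tensor_power)
  have "word p \<in> (tensor_power N 2 :: 'a freealg set)" using w by (simp add: word_in_tensor_power)
  moreover from this have "T_shift q q' m 0 (word p) \<in> tensor_power N 2"
    by (rule T_shift_tensor_power) simp
  ultimately show ?case
    using T_shift_quadratic_two[OF assms(1), of m a b]
    by (simp add: ww p T_shift_simps loc distrib_left distrib_right
        scal_add_right scal_mult_left scal_mult_right)
       (simp add: scal_scal mult.commute)
qed (simp_all add: T_shift_simps scal_add_right)

lemma T_shift_braid:
  fixes q q' :: "'a::comm_ring_1"
  assumes "q * q' = 1" "x \<in> tensor_power N r" "j + 3 \<le> r"
  shows "T_shift q q' m j (T_shift q q' m (j + 1) (T_shift q q' m j x)) =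
    T_shift q q' m (j + 1) (T_shift q q' m j (T_shift q q' m (j + 1) x))"
  using assms(2)
proof (induction x rule: tensor_power_induct)
  case (basis c w)
  have "w \<in> tensor_words N (j + 3 + (r - (j + 3)))"
    using basis assms(3) by (simp only: le_add_diff_inverse)
  then obtain u p v where w: "w = u @ p @ v" "u \<in> tensor_words N j" "p \<in> tensor_words N 3"
    by (rule tensor_words_split3)
  have ww: "word w = word u * word p * (word v :: 'a freealg)"
    using w(1) by (simp add: word_mult)
  obtain a b d where p: "p = [a, b, d]"
    using w(3) by (auto simp: tensor_words_def numeral_3_eq_3 length_Suc_conv)
  \<comment> \<open>The offsets \<open>i = 0\<close> and \<open>i = 1\<close> cover both operators
    of the braid relation inside one window of three letters.\<close>
  have loc: "T_shift q q' m (j + i) (word u * y * word v) = word u * T_shift q q' m i y * word v"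
    if "i \<le> 1" "y \<in> tensor_power N 3" for y i
    using T_shift_local[of "word u" N j y 3 i] w that by (simp add: word_in_tensor_power)
  have tp: "word p \<in> (tensor_power N 3 :: 'a freealg set)" using w by (simp add: word_in_tensor_power)
  have tp': "T_shift q q' m i y \<in> tensor_power N 3" if "i \<le> 1" "y \<in> tensor_power N 3" for i y
    using that by (intro T_shift_tensor_power) auto
  show ?case
    using T_shift_braid_three[OF assms(1), of m a b d] tp tp' loc[of 0] loc[of 1]
    by (simp add: ww p T_shift_simps)
qed (simp_all add: T_shift_simps)

text \<open>The active pairs are disjoint: one operator changes only \<open>p\<close>, the other
  only the last two letters of \<open>v\<close>.\<close>

lemma T_shift_commute:
  fixes q q' :: "'a::comm_ring_1"
  assumes "x \<in> tensor_power N r" "i + 2 \<le> j" "j + 2 \<le> r"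
  shows "T_shift q q' m i (T_shift q q' m j x) = T_shift q q' m j (T_shift q q' m i x)"
  using assms(1)
proof (induction x rule: tensor_power_induct)
  case (basis c w)
  obtain k where j: "j = i + 2 + k" using assms(2) le_Suc_ex by blast
  obtain l where "r = j + 2 + l" using assms(3) le_Suc_ex by blast
  with basis have "w \<in> tensor_words N (i + 2 + (k + 2 + l))"
    by (simp add: j ac_simps)
  then obtain u p y where w: "w = u @ p @ y" "u \<in> tensor_words N i" "p \<in> tensor_words N 2"
    and "y \<in> tensor_words N (k + 2 + l)"
    by (rule tensor_words_split3)
  from this(4) obtain v s where v: "y = v @ s" "v \<in> tensor_words N (k + 2)"
    by (rule tensor_words_split)
  have ww: "word w = word u * word p * (word v * word s :: 'a freealg)"
    using w(1) v(1) by (simp add: word_mult)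
  have loc1: "T_shift q q' m i (word u * word p * y) = word u * T_shift q q' m 0 (word p) * y" for y
    using T_shift_local[of "word u" N i "word p" 2 0] w by (simp add: word_in_tensor_power)
  \<comment> \<open>A general \<open>y\<close> allows use both before and after the other operator
    has changed \<open>word p\<close>.\<close>
  have loc2: "T_shift q q' m j (word u * y * (word v * word s)) =
      word u * y * (T_shift q q' m k (word v) * word s)" if "y \<in> tensor_power N 2" for y
  proof -
    have "word u * y \<in> tensor_power N (i + 2)"
      using w(2) that by (intro tensor_power_mult) (simp_all only: word_in_tensor_power)
    then show ?thesis
      using T_shift_local[of "word u * y" N "i + 2" "word v" "k + 2" k q q' m "word s"] v(2) j
      by (simp add: word_in_tensor_power mult.assoc)
  qed
  have "word p \<in> (tensor_power N 2 :: 'a freealg set)" using w by (simp add: word_in_tensor_power)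
  moreover from this have "T_shift q q' m 0 (word p) \<in> tensor_power N 2"
    by (rule T_shift_tensor_power) simp
  ultimately show ?case
    by (simp add: ww T_shift_simps loc1 loc2)
qed (simp_all add: T_shift_simps)

section \<open>The action of the free algebra\<close>

text \<open>The first letter acts first, as required for operators written on the right. The shift
  by one passes from generators numbered from \<open>1\<close> to positions numbered from
  \<open>0\<close>.\<close>

primrec word_act ::
  "'a::comm_ring_1 \<Rightarrow> 'a \<Rightarrow> nat \<Rightarrow> nat list \<Rightarrow> 'a freealg \<Rightarrow> 'a freealg" where
  "word_act q q' m [] x = x"
| "word_act q q' m (i # w) x = word_act q q' m w (T_shift q q' m (i - 1) x)"

definition free_act ::
  "'a::comm_ring_1 \<Rightarrow> 'a \<Rightarrow> nat \<Rightarrow> 'a freealg \<Rightarrow> 'a freealg \<Rightarrow> 'a freealg" where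
  "free_act q q' m a x = lin_ext (\<lambda>w. word_act q q' m w x) a"

lemma word_act_simps:
  "word_act q q' m w 0 = 0"
  "word_act q q' m w (x + y) = word_act q q' m w x + word_act q q' m w y"
  "word_act q q' m w (scal c x) = scal c (word_act q q' m w x)"
  by (induction w arbitrary: x y) (simp_all add: T_shift_simps)

lemma word_act_append: "word_act q q' m (u @ w) x = word_act q q' m w (word_act q q' m u x)"
  by (induction u arbitrary: x) simp_all

lemma word_act_tensor_power:
  "w \<in> lists {1..<r} \<Longrightarrow> x \<in> tensor_power N r \<Longrightarrow> word_act q q' m w x \<in> tensor_power N r"
  by (induction w arbitrary: x) (auto simp: T_shift_tensor_power)

lemma free_act_left:
  "free_act q q' m 0 x = 0"
  "free_act q q' m (a + b) x = free_act q q' m a x + free_act q q' m b x"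
  "free_act q q' m (a - b) x = free_act q q' m a x - free_act q q' m b x"
  "free_act q q' m (scal c a) x = scal c (free_act q q' m a x)"
  "free_act q q' m (word w) x = word_act q q' m w x"
  by (simp_all add: free_act_def lin_ext_simps)

lemma free_act_one: "free_act q q' m 1 x = x"
  using free_act_left(5)[of q q' m "[]" x] by (simp add: word_Nil)

lemma free_act_right:
  "free_act q q' m a 0 = 0"
  "free_act q q' m a (x + y) = free_act q q' m a x + free_act q q' m a y"
  "free_act q q' m a (scal c x) = scal c (free_act q q' m a x)"
  by (simp_all add: free_act_def lin_ext_def word_act_simps scal_add_right sum.distrib scal_sum
      scal_scal mult.commute)

text \<open>For words this is \<open>word_act_append\<close>; bilinearity in \<open>a\<close> and
  \<open>b\<close> gives the rest. The left factor acts first, in accordance with a right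
  action.\<close>

lemma free_act_mult: "free_act q q' m (a * b) x = free_act q q' m b (free_act q q' m a x)"
proof -
  have "Poly_Mapping.keys a \<subseteq> UNIV" by simp
  then show ?thesis
  proof (induction a rule: freealg_induct)
    case (basis c u)
    have "Poly_Mapping.keys b \<subseteq> UNIV" by simp
    then show ?case
      by (induction b rule: freealg_induct)
        (simp_all add: free_act_left free_act_right distrib_left scal_add_right scal_mult_left
          scal_mult_right word_mult word_act_append word_act_simps scal_scal mult.commute)
  qed (simp_all add: free_act_left free_act_right distrib_right)
qed

lemma free_act_tensor_power:
  assumes "a \<in> carrier (free_algebra {1..<r})" "x \<in> tensor_power N r"
  shows "free_act q q' m a x \<in> tensor_power N r"
  unfolding free_act_def lin_ext_def
  by (intro tensor_power_sum tensor_power_scal word_act_tensor_power)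
    (use assms in \<open>auto simp: free_algebra_def\<close>)

section \<open>Closure properties and vanishing of the Hecke ideal\<close>

lemma free_algebra_simps:
  "mult (free_algebra G) = (*)" "one (free_algebra G) = 1"
  "zero (free_algebra G) = 0" "add (free_algebra G) = (+)"
  by (simp_all add: free_algebra_def)

lemma word_in_free_algebra: "word w \<in> carrier (free_algebra G) \<longleftrightarrow> w \<in> lists G"
  by (simp add: free_algebra_def keys_word)

lemma free_algebra_ring_closed:
  fixes a b :: "'a::comm_ring_1 freealg"
  shows "0 \<in> carrier (free_algebra G :: 'a freealg ring)"
    and "1 \<in> carrier (free_algebra G :: 'a freealg ring)"
    and "a \<in> carrier (free_algebra G) \<Longrightarrow> b \<in> carrier (free_algebra G) \<Longrightarrow>
      a + b \<in> carrier (free_algebra G)"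
    and "a \<in> carrier (free_algebra G) \<Longrightarrow> b \<in> carrier (free_algebra G) \<Longrightarrow>
      a * b \<in> carrier (free_algebra G)"
  using ring.ring_simprules(1,2,5,6)[OF ring_free_algebra[of G, where 'a='a]]
  by (simp_all add: free_algebra_simps)

lemma free_algebra_uminus_closed:
  "a \<in> carrier (free_algebra G) \<Longrightarrow> - a \<in> carrier (free_algebra G)"
  by (simp add: free_algebra_def keys_minus)

lemma free_algebra_diff_closed:
  "a \<in> carrier (free_algebra G) \<Longrightarrow> b \<in> carrier (free_algebra G) \<Longrightarrow>
    a - b \<in> carrier (free_algebra G)"
  using free_algebra_ring_closed(3)[of a G "- b"] by (simp add: free_algebra_uminus_closed)

lemma free_algebra_scal_closed:
  "a \<in> carrier (free_algebra G) \<Longrightarrow> scal c a \<in> carrier (free_algebra G)"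
  using keys_scal[of c a] by (auto simp: free_algebra_def)

lemmas free_algebra_closed =
  free_algebra_ring_closed free_algebra_uminus_closed free_algebra_diff_closed
  free_algebra_scal_closed

lemma hecke_relations_closed: "hecke_relations q q' r \<subseteq> carrier (free_algebra {1..<r})"
  unfolding hecke_relations_def
  by (auto simp: word_in_free_algebra intro!: free_algebra_closed)

lemma ideal_hecke_ideal: "ideal (hecke_ideal q q' r) (free_algebra {1..<r})"
  unfolding hecke_ideal_def
  by (intro ring.genideal_ideal ring_free_algebra hecke_relations_closed)

lemma hecke_relations_act:
  assumes "q * q' = 1" "a \<in> hecke_relations q q' r" "x \<in> tensor_power N r"
  shows "free_act q q' m a x = 0"
  using assms(2) unfolding hecke_relations_def
proof (elim UnE CollectE exE conjE)
  fix i assume "a = word [i] * word [i] - (scal (q - q') (word [i]) + 1)" "1 \<le> i" "i < r"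
  then show ?thesis
    using T_shift_quadratic[OF assms(1,3), of "i - 1" m]
    by (simp add: free_act_left free_act_mult free_act_one)
next
  fix i assume "a = word [i] * word [i+1] * word [i] - word [i+1] * word [i] * word [i+1]"
    "1 \<le> i" "i + 1 < r"
  then show ?thesis
    using T_shift_braid[OF assms(1,3), of "i - 1" m]
    by (simp add: free_act_left free_act_mult)
next
  fix i j assume a: "a = word [i] * word [j] - word [j] * word [i]"
    and ij: "1 \<le> i" "i < r" "1 \<le> j" "j < r" "\<bar>int i - int j\<bar> > 1"
  \<comment> \<open>The distance condition says that one active pair lies entirely before the other,
    in either order.\<close>
  have r: "i - 1 + 2 \<le> r" "j - 1 + 2 \<le> r" and "i - 1 + 2 \<le> j - 1 \<or> j - 1 + 2 \<le> i - 1"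
    using ij by linarith+
  from this(3) have "T_shift q q' m (i - 1) (T_shift q q' m (j - 1) x) =
      T_shift q q' m (j - 1) (T_shift q q' m (i - 1) x)"
    by (elim disjE) (rule T_shift_commute[OF assms(3) _ r(2)] T_shift_commute[OF assms(3) _ r(1), symmetric];
      assumption)+
  with a show ?thesis
    by (simp add: free_act_left free_act_mult)
qed

text \<open>The annihilator \<open>?K\<close> of the tensor power contains the relations, so it
  contains the ideal they generate once it is known to be two-sided. Left multiples stay in it
  because the free algebra preserves the tensor power, right multiples because every element sends
  \<open>0\<close> to \<open>0\<close>.\<close>

lemma hecke_ideal_act:
  fixes q q' :: "'a::comm_ring_1"
  assumes "q * q' = 1" "a \<in> hecke_ideal q q' r" "x \<in> tensor_power N r"
  shows "free_act q q' m a x = 0"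
proof -
  let ?F = "free_algebra {1..<r} :: 'a freealg ring"
  let ?M = "tensor_power N r :: 'a freealg set"
  let ?K = "{a \<in> carrier ?F. \<forall>x\<in>?M. free_act q q' m a x = 0}"
  have F: "ring ?F" by (rule ring_free_algebra)
  \<comment> \<open>The subgroup criterion uses the inverse of the additive monoid, which is
    identified here with the ordinary negative.\<close>
  have inv: "\<ominus>\<^bsub>?F\<^esub> a = - a" if "a \<in> carrier ?F" for a
    using that abelian_group.minus_equality[OF ring.is_abelian_group[OF F], of "- a" a]
    by (simp add: free_algebra_simps free_algebra_closed)
  have "ideal ?K ?F"
  proof (rule idealI)
    show "subgroup ?K (add_monoid ?F)"
    proof (rule group.subgroupI[OF abelian_group.a_group[OF ring.is_abelian_group[OF F]]])
      fix a assume "a \<in> ?K"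
      then show "inv\<^bsub>add_monoid ?F\<^esub> a \<in> ?K"
        using free_act_left(3)[of q q' m 0 a]
        by (simp only: mem_Collect_eq inv[unfolded a_inv_def])
          (simp add: free_algebra_closed free_act_left(1))
    qed (auto simp: free_algebra_simps free_algebra_closed free_act_left intro!: exI[of _ 0])
  qed (auto simp: free_algebra_simps free_algebra_closed free_act_mult free_act_right
      free_act_tensor_power ring_free_algebra)
  moreover have "hecke_relations q q' r \<subseteq> ?K"
    using hecke_relations_closed[of q q' r] hecke_relations_act[OF assms(1)] by blast
  ultimately have "hecke_ideal q q' r \<subseteq> ?K"
    unfolding hecke_ideal_def by (rule ring.genideal_minimal[OF F])
  then show ?thesis using assms(2,3) by blast
qed

section \<open>Computing with representatives in the quotient\<close>

lemma hecke_simps: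
  fixes q q' :: "'a::comm_ring_1"
  shows "carrier (hecke q q' r) = hecke_class q q' r ` carrier (free_algebra {1..<r})"
    and "one (hecke q q' r) = hecke_class q q' r 1"
    and "a \<in> carrier (free_algebra {1..<r}) \<Longrightarrow> b \<in> carrier (free_algebra {1..<r}) \<Longrightarrow>
      hecke_class q q' r a \<otimes>\<^bsub>hecke q q' r\<^esub> hecke_class q q' r b = hecke_class q q' r (a * b)"
    and "a \<in> carrier (free_algebra {1..<r}) \<Longrightarrow> b \<in> carrier (free_algebra {1..<r}) \<Longrightarrow>
      hecke_class q q' r a \<oplus>\<^bsub>hecke q q' r\<^esub> hecke_class q q' r b = hecke_class q q' r (a + b)"
    and "a \<in> carrier (free_algebra {1..<r}) \<Longrightarrow>
      c \<odot>\<^bsub>hecke q q' r\<^esub> hecke_class q q' r a = hecke_class q q' r (scal c a)"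
proof -
  let ?F = "free_algebra {1..<r} :: 'a freealg ring"
  note I = ideal_hecke_ideal[of q q' r]
  note defs = hecke_def Let_def FactRing_def hecke_class_def
  show "carrier (hecke q q' r) = hecke_class q q' r ` carrier ?F"
    by (auto simp: defs A_RCOSETS_def')
  show "one (hecke q q' r) = hecke_class q q' r 1"
    by (simp add: defs free_algebra_simps)
  show "a \<in> carrier ?F \<Longrightarrow> b \<in> carrier ?F \<Longrightarrow>
      hecke_class q q' r a \<otimes>\<^bsub>hecke q q' r\<^esub> hecke_class q q' r b = hecke_class q q' r (a * b)"
    using ideal.rcoset_mult_add[OF I, of a b] by (simp add: defs free_algebra_simps)
  show "a \<in> carrier ?F \<Longrightarrow> b \<in> carrier ?F \<Longrightarrow>
      hecke_class q q' r a \<oplus>\<^bsub>hecke q q' r\<^esub> hecke_class q q' r b = hecke_class q q' r (a + b)"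
    using ideal.a_rcos_sum[OF I, of a b] by (simp add: defs free_algebra_simps)
  show "a \<in> carrier ?F \<Longrightarrow>
      c \<odot>\<^bsub>hecke q q' r\<^esub> hecke_class q q' r a = hecke_class q q' r (scal c a)"
    using ideal.rcoset_mult_add[OF I, of "scal c 1" a]
    by (simp add: defs free_algebra_simps free_algebra_closed scal_mult_left)
qed

text \<open>Well-definedness on the quotient: representatives of one class differ by an element of
  the ideal, which acts as zero.\<close>

lemma hecke_class_act:
  assumes "q * q' = 1" "a \<in> carrier (free_algebra {1..<r})" "b \<in> carrier (free_algebra {1..<r})"
    and "hecke_class q q' r a = hecke_class q q' r b" "x \<in> tensor_power N r"
  shows "free_act q q' m a x = free_act q q' m b x"
proof -
  have "0 \<in> hecke_ideal q q' r"
    using additive_subgroup.zero_closed[OF ideal.axioms(1)[OF ideal_hecke_ideal[of q q' r]]]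
    by (simp add: free_algebra_simps)
  then have "a \<in> hecke_class q q' r a"
    by (force simp: hecke_class_def a_r_coset_def' free_algebra_simps)
  with assms(4) have "a \<in> hecke_class q q' r b" by simp
  then obtain h where "h \<in> hecke_ideal q q' r" "a = h + b"
    by (auto simp: hecke_class_def a_r_coset_def' free_algebra_simps)
  then show ?thesis
    using hecke_ideal_act[OF assms(1) _ assms(5)] by (simp add: free_act_left)
qed

section \<open>The representation of the Hecke algebra\<close>

text \<open>The choice of representative is harmless by \<open>hecke_class_act\<close>. Both
  arguments are restricted, to match \<open>extensional\<close> and the function space in
  \<open>right_End\<close>.\<close>

definition hecke_act ::
  "'a::comm_ring_1 \<Rightarrow> 'a \<Rightarrow> nat \<Rightarrow> nat \<Rightarrow> nat \<Rightarrow> 'a freealg set \<Rightarrow> 'a freealg \<Rightarrow> 'a freealg" where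
  "hecke_act q q' m N r =
    (\<lambda>X\<in>carrier (hecke q q' r). \<lambda>x\<in>tensor_power N r.
      free_act q q' m (SOME a. a \<in> carrier (free_algebra {1..<r}) \<and> hecke_class q q' r a = X) x)"

lemma hecke_act_class:
  assumes "q * q' = 1" "a \<in> carrier (free_algebra {1..<r})"
  shows "hecke_act q q' m N r (hecke_class q q' r a) =
    restrict (free_act q q' m a) (tensor_power N r)"
proof -
  define b where "b = (SOME b. b \<in> carrier (free_algebra {1..<r}) \<and>
    hecke_class q q' r b = hecke_class q q' r a)"
  have b: "b \<in> carrier (free_algebra {1..<r}) \<and> hecke_class q q' r b = hecke_class q q' r a"
    unfolding b_def by (rule someI[of _ a]) (use assms(2) in simp)
  have "hecke_act q q' m N r (hecke_class q q' r a) =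
      restrict (free_act q q' m b) (tensor_power N r)"
    using assms(2) by (simp add: hecke_act_def hecke_simps(1) b_def)
  also have "\<dots> = restrict (free_act q q' m a) (tensor_power N r)"
    using hecke_class_act[OF assms(1) _ assms(2)] b by (blast intro: restrict_ext)
  finally show ?thesis .
qed

lemma hecke_act_representation:
  assumes "q * q' = 1"
  shows "right_representation (hecke q q' r) (tensor_power N r) (hecke_act q q' m N r)"
  unfolding right_representation_def algebra_hom_def
proof (intro conjI CollectI ballI allI ring_hom_memI)
  note simps = hecke_simps hecke_act_class[OF assms] free_algebra_closed right_End_def
    free_act_tensor_power free_act_left free_act_right
  show "hecke_act q q' m N r \<in> extensional (carrier (hecke q q' r))"
    by (simp add: hecke_act_def)
  show "hecke_act q q' m N r \<one>\<^bsub>hecke q q' r\<^esub> = \<one>\<^bsub>right_End (tensor_power N r)\<^esub>"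
    by (simp add: simps free_act_one restrict_def fun_eq_iff)
  fix X assume "X \<in> carrier (hecke q q' r)"
  then obtain a where a: "a \<in> carrier (free_algebra {1..<r})" "X = hecke_class q q' r a"
    by (auto simp: hecke_simps)
  show "hecke_act q q' m N r X \<in> carrier (right_End (tensor_power N r))"
    using a by (auto simp: simps lin_on_def tensor_power_add tensor_power_scal)
  show "hecke_act q q' m N r (c \<odot>\<^bsub>hecke q q' r\<^esub> X) =
      c \<odot>\<^bsub>right_End (tensor_power N r)\<^esub> hecke_act q q' m N r X" for c
    using a by (simp add: simps cong: restrict_cong)
  fix Y assume "Y \<in> carrier (hecke q q' r)"
  then obtain b where b: "b \<in> carrier (free_algebra {1..<r})" "Y = hecke_class q q' r b"
    by (auto simp: hecke_simps)
  show "hecke_act q q' m N r (X \<otimes>\<^bsub>hecke q q' r\<^esub> Y) =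
      hecke_act q q' m N r X \<otimes>\<^bsub>right_End (tensor_power N r)\<^esub> hecke_act q q' m N r Y"
    using a b by (simp add: simps compose_def free_act_mult cong: restrict_cong)
  show "hecke_act q q' m N r (X \<oplus>\<^bsub>hecke q q' r\<^esub> Y) =
      hecke_act q q' m N r X \<oplus>\<^bsub>right_End (tensor_power N r)\<^esub> hecke_act q q' m N r Y"
    using a b by (simp add: simps cong: restrict_cong)
qed

text \<open>Multiplicativity carries agreement from the generators to all words, and linearity from
  words to the whole algebra.\<close>

lemma right_representation_eqI:
  fixes q q' :: "'a::comm_ring_1"
  assumes \<rho>: "right_representation (hecke q q' r) M \<rho>"
    and \<sigma>: "right_representation (hecke q q' r) M \<sigma>"
    and gen: "\<And>i. 1 \<le> i \<Longrightarrow> i < r \<Longrightarrow> \<rho> (hecke_gen q q' r i) = \<sigma> (hecke_gen q q' r i)"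
  shows "\<rho> = \<sigma>"
proof (rule extensionalityI)
  let ?H = "hecke q q' r" and ?cl = "hecke_class q q' r"
  let ?F = "free_algebra {1..<r} :: 'a freealg ring"
  show "\<rho> \<in> extensional (carrier ?H)" "\<sigma> \<in> extensional (carrier ?H)"
    using \<rho> \<sigma> by (simp_all add: right_representation_def)
  have hom: "\<rho> \<in> algebra_hom ?H (right_End M)" "\<sigma> \<in> algebra_hom ?H (right_End M)"
    using \<rho> \<sigma> by (simp_all add: right_representation_def)
  have cl: "?cl a \<in> carrier ?H" if "a \<in> carrier ?F" for a
    using that by (simp add: hecke_simps)
  have smult: "h (?cl (scal c a)) = c \<odot>\<^bsub>right_End M\<^esub> h (?cl a)"
    if "a \<in> carrier ?F" "h \<in> algebra_hom ?H (right_End M)" for h a c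
    using that cl[of a] by (simp add: algebra_hom_def flip: hecke_simps)
  have plus: "h (?cl (a + b)) = h (?cl a) \<oplus>\<^bsub>right_End M\<^esub> h (?cl b)"
    if "a \<in> carrier ?F" "b \<in> carrier ?F" "h \<in> algebra_hom ?H (right_End M)" for h a b
    using that cl[of a] cl[of b] by (simp add: algebra_hom_def ring_hom_add flip: hecke_simps)
  have mult: "h (?cl (a * b)) = h (?cl a) \<otimes>\<^bsub>right_End M\<^esub> h (?cl b)"
    if "a \<in> carrier ?F" "b \<in> carrier ?F" "h \<in> algebra_hom ?H (right_End M)" for h a b
    using that cl[of a] cl[of b] by (simp add: algebra_hom_def ring_hom_mult flip: hecke_simps)
  have one: "h (?cl 1) = \<one>\<^bsub>right_End M\<^esub>" if "h \<in> algebra_hom ?H (right_End M)" for h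
    using that by (simp add: algebra_hom_def ring_hom_one flip: hecke_simps)
  have words: "\<rho> (?cl (word w)) = \<sigma> (?cl (word w))" if "w \<in> lists {1..<r}" for w
    using that
  proof (induction w)
    case Nil
    then show ?case using hom by (simp add: word_Nil one)
  next
    case (Cons i w)
    have "word (i # w) = (word [i] * word w :: 'a freealg)" by (simp add: word_mult)
    moreover have "word [i] \<in> carrier ?F" "word w \<in> carrier ?F"
      using Cons by (simp_all add: word_in_free_algebra)
    ultimately show ?case
      using Cons gen[of i] by (simp add: mult[OF _ _ hom(1)] mult[OF _ _ hom(2)] hecke_gen_def)
  qed
  fix X assume "X \<in> carrier ?H"
  then obtain a where a: "Poly_Mapping.keys a \<subseteq> lists {1..<r}" "X = ?cl a"
    by (auto simp: hecke_simps free_algebra_def)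
  have "\<rho> (?cl a) = \<sigma> (?cl a)"
    using a(1)
  proof (induction a rule: freealg_induct)
    case zero
    \<comment> \<open>\<open>ring_hom\<close> does not include preservation of zero, so
      \<open>0\<close> is written as \<open>scal 0 1\<close>; both values are then the zero multiple
      of the unit.\<close>
    show ?case using smult[of 1 _ 0] hom by (simp add: free_algebra_closed one)
  next
    case (add a b)
    then show ?case using plus hom
      by (simp add: free_algebra_def)
  next
    case (basis c w)
    then show ?case using smult hom words by (simp add: word_in_free_algebra)
  qed
  then show "\<rho> X = \<sigma> X" using a by simp
qed

theorem theorem2p1:
  fixes q q' :: "'a::idom" and m n r :: nat
  assumes "q * q' = 1" and "m + n \<ge> 1" and "r \<ge> 1"
  shows "\<exists>!\<pi>. right_representation (hecke q q' r) (tensor_power (m + n) r) \<pi> \<and>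
              (\<forall>i. 1 \<le> i \<and> i \<le> r - 1 \<longrightarrow> \<pi> (hecke_gen q q' r i) = T_at q q' m n r i)"
proof (rule ex1I[of _ "hecke_act q q' m (m + n) r"])
  have gen: "hecke_act q q' m (m + n) r (hecke_gen q q' r i) = T_at q q' m n r i"
    if "1 \<le> i" "i < r" for i
    using that
    by (simp add: hecke_gen_def hecke_act_class[OF assms(1)] word_in_free_algebra T_at_eq
        free_act_left cong: restrict_cong)
  \<comment> \<open>Subtraction on naturals is truncated; \<open>r \<ge> 1\<close> makes the two
    bounds equivalent.\<close>
  have bound: "i \<le> r - 1 \<longleftrightarrow> i < r" for i using assms(3) by auto
  show "right_representation (hecke q q' r) (tensor_power (m + n) r) (hecke_act q q' m (m + n) r) \<and>
      (\<forall>i. 1 \<le> i \<and> i \<le> r - 1 \<longrightarrow>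
        hecke_act q q' m (m + n) r (hecke_gen q q' r i) = T_at q q' m n r i)"
    using hecke_act_representation[OF assms(1)] gen bound by blast
  show "\<pi> = hecke_act q q' m (m + n) r"
    if "right_representation (hecke q q' r) (tensor_power (m + n) r) \<pi> \<and>
      (\<forall>i. 1 \<le> i \<and> i \<le> r - 1 \<longrightarrow> \<pi> (hecke_gen q q' r i) = T_at q q' m n r i)" for \<pi>
    using that gen bound hecke_act_representation[OF assms(1)]
    by (intro right_representation_eqI[of q q' r "tensor_power (m + n) r"]) auto
qed

end
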